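(* Let $(M,g)$ be a smooth Riemannian manifold of dimension $n\ge2$, possibly with boundary, and let $f:M\to\mathbb R$ be a smooth function that attains its maximum value $f_{\max}$, such that $\mathrm{MAX}(f)=\{x\in M: f(x)=f_{\max}\}$ does not meet the boundary of $M$. Let $\Sigma$ be a connected component of $\mathrm{MAX}(f)$. If $\Sigma$ is compact, then for every $\theta<1$ there exist an open neighborhood $\Omega\supset\Sigma$ and a real number $c>0$ such that for every $x\in\Omega$ $$|\nabla f|^2(x)\le c\,[f_{\max}-f(x)]^{\theta}.$$
   Context: $\nabla f$ and $|\cdot|$ are the gradient and norm with respect to $g$. *)

theory Defs
  imports "HOL-Analysis.Analysis"
begin

section \<open>Smooth maps\<close>

text \<open>
  \<^term>\<open>Ck_on\<close> is meant for open sets. On a finite-dimensional domain, asking all directional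
  derivatives to be of class \<open>C\<^sup>k\<close> is the usual recursive definition of class \<open>C\<^sup>k\<^sup>+\<^sup>1\<close>.
\<close>

primrec Ck_on :: "nat \<Rightarrow> ('a::real_normed_vector \<Rightarrow> 'b::real_normed_vector) \<Rightarrow> 'a set \<Rightarrow> bool" where
  "Ck_on 0 f S \<longleftrightarrow> continuous_on S f"
| "Ck_on (Suc k) f S \<longleftrightarrow>
     (\<forall>x\<in>S. f differentiable at x) \<and> (\<forall>v. Ck_on k (\<lambda>x. frechet_derivative f (at x) v) S)"

text \<open>Smoothness on an arbitrary set is existence of local smooth extensions, as usual for subsets
  of a half-space.\<close>

definition smooth_on :: "('a::real_normed_vector \<Rightarrow> 'b::real_normed_vector) \<Rightarrow> 'a set \<Rightarrow> bool" where
  "smooth_on f S \<longleftrightarrow>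
     (\<forall>x\<in>S. \<exists>W h. open W \<and> x \<in> W \<and> (\<forall>k. Ck_on k h W) \<and> (\<forall>y\<in>S \<inter> W. h y = f y))"


section \<open>Smooth manifolds with boundary\<close>

text \<open>
  A chart is a pair of its domain and its coordinate map (with irrelevant values off the domain).
  The index type has no distinguished coordinate, so boundary charts may use the half-space of
  any coordinate.
\<close>

type_synonym ('a, 'n) chart = "'a set \<times> ('a \<Rightarrow> real ^ 'n)"

definition half_space :: "'n::finite \<Rightarrow> (real ^ 'n) set" where
  "half_space k = {x. 0 \<le> x $ k}"

definition chart_image :: "('a, 'n::finite) chart \<Rightarrow> (real ^ 'n) set" where
  "chart_image c = snd c ` fst c"

definition chart_inv :: "('a, 'n::finite) chart \<Rightarrow> real ^ 'n \<Rightarrow> 'a" where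
  "chart_inv c = inv_into (fst c) (snd c)"

definition is_chart :: "'a topology \<Rightarrow> ('a, 'n::finite) chart \<Rightarrow> bool" where
  "is_chart M c \<longleftrightarrow>
     openin M (fst c) \<and>
     (open (chart_image c) \<or> (\<exists>k. openin (top_of_set (half_space k)) (chart_image c))) \<and>
     homeomorphic_map (subtopology M (fst c)) (top_of_set (chart_image c)) (snd c)"

definition transition :: "('a, 'n::finite) chart \<Rightarrow> ('a, 'n) chart \<Rightarrow> real ^ 'n \<Rightarrow> real ^ 'n" where
  "transition c d = snd d \<circ> chart_inv c"

text \<open>The atlas is not required to be maximal; the notions below depend only on the smooth
  structure it generates.\<close>

locale smooth_manifold_with_boundary =
  fixes M :: "'a topology" and A :: "('a, 'n::finite) chart set"
  assumes Hausdorff: "Hausdorff_space M"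
    and second_countable: "second_countable M"
    and charts: "\<And>c. c \<in> A \<Longrightarrow> is_chart M c"
    and covering: "(\<Union>c\<in>A. fst c) = topspace M"
    and compatible: "\<And>c d. c \<in> A \<Longrightarrow> d \<in> A \<Longrightarrow>
          smooth_on (transition c d) (snd c ` (fst c \<inter> fst d))"

definition manifold_boundary :: "('a, 'n::finite) chart set \<Rightarrow> 'a set" where
  "manifold_boundary A =
     {p. \<exists>c\<in>A. \<exists>k. p \<in> fst c \<and> openin (top_of_set (half_space k)) (chart_image c)
                     \<and> snd c p $ k = 0}"

definition smooth_function :: "('a, 'n::finite) chart set \<Rightarrow> ('a \<Rightarrow> real) \<Rightarrow> bool" where
  "smooth_function A f \<longleftrightarrow> (\<forall>c\<in>A. smooth_on (f \<circ> chart_inv c) (chart_image c))"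


section \<open>Tangent vectors\<close>

text \<open>
  A tangent vector at \<open>p\<close> is the family of its coordinate representations in all charts around
  \<open>p\<close>, related by the derivatives of the transition maps; the family is 0 at all other arguments,
  so that distinct families are distinct vectors. Derivatives are taken within the chart image,
  which determines them uniquely also at boundary points.
\<close>

type_synonym ('a, 'n) tangent = "('a, 'n) chart \<Rightarrow> real ^ 'n"

definition transition_deriv ::
    "('a, 'n::finite) chart \<Rightarrow> ('a, 'n) chart \<Rightarrow> 'a \<Rightarrow> real ^ 'n \<Rightarrow> real ^ 'n" where
  "transition_deriv c d p =
     frechet_derivative (transition c d) (at (snd c p) within snd c ` (fst c \<inter> fst d))"

definition tangent_space :: "('a, 'n::finite) chart set \<Rightarrow> 'a \<Rightarrow> ('a, 'n) tangent set" where
  "tangent_space A p =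
     {v. (\<forall>c. c \<notin> A \<or> p \<notin> fst c \<longrightarrow> v c = 0) \<and>
         (\<forall>c\<in>A. \<forall>d\<in>A. p \<in> fst c \<and> p \<in> fst d \<longrightarrow> v d = transition_deriv c d p (v c))}"

text \<open>The \<open>i\<close>-th coordinate vector \<open>\<partial>/\<partial>x\<^sup>i\<close> at \<open>p\<close> of the chart \<open>c\<close>.\<close>

definition coord_vector ::
    "('a, 'n::finite) chart set \<Rightarrow> ('a, 'n) chart \<Rightarrow> 'n \<Rightarrow> 'a \<Rightarrow> ('a, 'n) tangent" where
  "coord_vector A c i p =
     (\<lambda>d. if d \<in> A \<and> p \<in> fst d then transition_deriv c d p (axis i 1) else 0)"

text \<open>The value \<open>df\<^sub>p(v)\<close>, computed in any chart around \<open>p\<close>.\<close>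

definition differential ::
    "('a, 'n::finite) chart set \<Rightarrow> ('a \<Rightarrow> real) \<Rightarrow> 'a \<Rightarrow> ('a, 'n) tangent \<Rightarrow> real" where
  "differential A f p v =
     (THE r. \<forall>c\<in>A. p \<in> fst c \<longrightarrow>
        r = frechet_derivative (f \<circ> chart_inv c) (at (snd c p) within chart_image c) (v c))"


section \<open>Riemannian metrics\<close>

locale riemannian_manifold_with_boundary = smooth_manifold_with_boundary M A
  for M :: "'a topology" and A :: "('a, 'n::finite) chart set" +
  fixes g :: "'a \<Rightarrow> ('a, 'n) tangent \<Rightarrow> ('a, 'n) tangent \<Rightarrow> real"
  assumes metric_linear: "\<And>p u v w a b. p \<in> topspace M \<Longrightarrow> u \<in> tangent_space A p \<Longrightarrow>
          v \<in> tangent_space A p \<Longrightarrow> w \<in> tangent_space A p \<Longrightarrow>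
          g p (\<lambda>c. a *\<^sub>R u c + b *\<^sub>R v c) w = a * g p u w + b * g p v w"
    and metric_sym: "\<And>p v w. p \<in> topspace M \<Longrightarrow> v \<in> tangent_space A p \<Longrightarrow>
          w \<in> tangent_space A p \<Longrightarrow> g p v w = g p w v"
    and metric_pos: "\<And>p v. p \<in> topspace M \<Longrightarrow> v \<in> tangent_space A p \<Longrightarrow>
          v \<noteq> (\<lambda>c. 0) \<Longrightarrow> 0 < g p v v"
    and metric_smooth: "\<And>c i j. c \<in> A \<Longrightarrow>
          smooth_on ((\<lambda>p. g p (coord_vector A c i p) (coord_vector A c j p)) \<circ> chart_inv c) (chart_image c)"

definition metric_norm ::
    "('a \<Rightarrow> ('a, 'n) tangent \<Rightarrow> ('a, 'n) tangent \<Rightarrow> real) \<Rightarrow> 'a \<Rightarrow> ('a, 'n::finite) tangent \<Rightarrow> real" where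
  "metric_norm g p v = sqrt (g p v v)"

definition gradient ::
    "('a, 'n::finite) chart set \<Rightarrow> ('a \<Rightarrow> ('a, 'n) tangent \<Rightarrow> ('a, 'n) tangent \<Rightarrow> real)
      \<Rightarrow> ('a \<Rightarrow> real) \<Rightarrow> 'a \<Rightarrow> ('a, 'n) tangent" where
  "gradient A g f p =
     (THE w. w \<in> tangent_space A p \<and> (\<forall>v\<in>tangent_space A p. g p w v = differential A f p v))"

end

theory Submission
  imports Defs
begin

text \<open>
  The estimate holds even with exponent 1. In an interior chart, \<open>f\<^sub>m\<^sub>a\<^sub>x - f\<close> is a nonnegative function
  whose second derivatives are bounded by \<open>K\<close> near a given point, so Taylor expansion along each
  coordinate direction gives \<open>(\<partial>\<^sub>i f)\<^sup>2 \<le> 2 K (f\<^sub>m\<^sub>a\<^sub>x - f)\<close>. On compact sets of coordinates the metric is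
  bounded below by \<open>\<mu> > 0\<close> times the Euclidean one, whence \<open>\<bar>\<nabla>f\<bar>\<^sup>2 \<le> (\<Sum>\<^sub>i (\<partial>\<^sub>i f)\<^sup>2) / \<mu>\<close>. Finitely many such
  neighbourhoods cover \<open>\<Sigma>\<close>, and \<open>t \<le> t powr \<theta>\<close> for \<open>0 \<le> t \<le> 1\<close>, also at \<open>t = 0\<close>, where both sides
  are 0 (\<open>0 powr \<theta> = 0\<close> for every \<open>\<theta>\<close>).
\<close>

section \<open>Functions on Euclidean space\<close>

lemma Ck_on_subset: "Ck_on k f S \<Longrightarrow> T \<subseteq> S \<Longrightarrow> Ck_on k f T"
proof (induction k arbitrary: f)
  case 0
  then show ?case using continuous_on_subset by simp blast
next
  case (Suc k)
  then show ?case by (metis Ck_on.simps(2) subsetD)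
qed

text \<open>Transfers a derivative from a local smooth extension to the function it extends. With
  \<open>W = UNIV\<close> it also serves for functions that agree only on \<open>S\<close>, as with
  composed transition maps.\<close>

lemma has_derivative_transform_within_inter:
  assumes "(h has_derivative D) (at x within S)" "open W" "x \<in> S \<inter> W" "\<forall>y\<in>S \<inter> W. h y = f y"
  shows "(f has_derivative D) (at x within S)"
proof -
  have "eventually (\<lambda>y. y \<in> W) (at x within S)"
    using assms(2,3) by (metis IntD2 eventually_at_topological)
  moreover have "eventually (\<lambda>y. y \<in> S) (at x within S)"
    by (auto simp: eventually_at_filter)
  ultimately have "eventually (\<lambda>y. h y = f y) (at x within S)"
    by eventually_elim (use assms(4) in auto)
  then show ?thesis
    by (rule has_derivative_transform_eventually[OF assms(1)]) (use assms(3,4) in auto)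
qed

lemma smooth_onE:
  assumes "smooth_on f S" "x \<in> S"
  obtains W h where "open W" "x \<in> W" "\<forall>k. Ck_on k h W" "\<forall>y\<in>S \<inter> W. h y = f y"
  using bspec[OF assms(1)[unfolded smooth_on_def] assms(2)] by (elim exE conjE)

text \<open>The derivative at \<open>x\<close> of a local smooth extension is also one within
  \<open>S\<close>. Hence \<open>frechet_derivative\<close> picks a genuine derivative; its
  uniqueness depends on the shape of \<open>S\<close> and is settled for chart images below.\<close>

lemma smooth_on_imp_has_derivative:
  assumes "smooth_on f S" "x \<in> S"
  shows "(f has_derivative frechet_derivative f (at x within S)) (at x within S)"
proof -
  obtain W h where W: "open W" "x \<in> W" "\<forall>k. Ck_on k h W" "\<forall>y\<in>S \<inter> W. h y = f y"
    by (rule smooth_onE[OF assms])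
  have "h differentiable at x" using spec[OF W(3), of "Suc 0"] W(2) by simp
  then have "(h has_derivative frechet_derivative h (at x)) (at x within S)"
    by (rule has_derivative_at_withinI[OF iffD1[OF frechet_derivative_works]])
  then have "(f has_derivative frechet_derivative h (at x)) (at x within S)"
    by (rule has_derivative_transform_within_inter[OF _ W(1) _ W(4)]) (use W(2) assms(2) in auto)
  then have "f differentiable (at x within S)" by (rule differentiableI)
  then show ?thesis by (rule iffD1[OF frechet_derivative_works])
qed

lemma smooth_on_imp_continuous_on: "smooth_on f S \<Longrightarrow> continuous_on S f"
  unfolding continuous_on_eq_continuous_within
  by (intro ballI has_derivative_continuous[OF smooth_on_imp_has_derivative])

text \<open>Uniqueness of derivatives within a set requires arbitrarily small nonzero steps along
  each basis vector. Basis vectors have nonnegative entries, so a positive step never leaves the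
  half-space, even from its boundary.\<close>

lemma half_space_forward_step:
  assumes "openin (top_of_set (half_space k)) S" "x \<in> S" "i \<in> Basis" "e > 0"
  shows "\<exists>d. 0 < \<bar>d\<bar> \<and> \<bar>d\<bar> < e \<and> x + d *\<^sub>R i \<in> S"
proof -
  obtain r where r: "r > 0" "ball x r \<inter> half_space k \<subseteq> S"
    using assms(1,2) unfolding openin_contains_ball by auto
  define d where "d = min r e / 2"
  have d: "d > 0" "d < r" "d < e" using r(1) assms(4) by (auto simp: d_def)
  have "x $ k \<ge> 0" using openin_imp_subset[OF assms(1)] assms(2) by (auto simp: half_space_def)
  moreover have "i $ k \<ge> 0" using assms(3) by (auto simp: Basis_vec_def axis_def)
  ultimately have "x + d *\<^sub>R i \<in> half_space k" using d by (simp add: half_space_def)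
  moreover have "x + d *\<^sub>R i \<in> ball x r"
    using d assms(3) by (simp add: dist_norm)
  ultimately have "x + d *\<^sub>R i \<in> S" using r by blast
  then show ?thesis using d by (intro exI[of _ d]) auto
qed

section \<open>First derivatives of functions with bounded second derivatives and a one-sided
  bound\<close>

text \<open>By Taylor, \<phi> lies below a parabola with leading coefficient K/2. At its vertex the
  parabola equals \<open>\<phi> 0 - (\<phi>' 0)\<^sup>2 / (2 * K)\<close>, which must therefore be
  nonnegative. The bound on \<open>\<phi>' 0\<close> places the vertex inside the interval.\<close>

lemma interval_nonneg_derivative_bound:
  fixes \<phi> :: "real \<Rightarrow> real"
  assumes "r > 0" "K > 0"
    and d1: "\<And>s. \<bar>s\<bar> \<le> r \<Longrightarrow> (\<phi> has_real_derivative \<phi>' s) (at s)"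
    and d2: "\<And>s. \<bar>s\<bar> \<le> r \<Longrightarrow> (\<phi>' has_real_derivative \<phi>'' s) (at s)"
    and nonneg: "\<And>s. \<bar>s\<bar> \<le> r \<Longrightarrow> \<phi> s \<ge> 0"
    and bound: "\<And>s. \<bar>s\<bar> \<le> r \<Longrightarrow> \<bar>\<phi>'' s\<bar> \<le> K" "\<bar>\<phi>' 0\<bar> \<le> K * r"
  shows "(\<phi>' 0)\<^sup>2 \<le> 2 * K * \<phi> 0"
proof (cases "\<phi>' 0 = 0")
  case True then show ?thesis using nonneg[of 0] assms by simp
next
  case False
  define s where "s = - \<phi>' 0 / K" \<comment> \<open>minimizes \<open>\<phi> 0 + \<phi>' 0 * s + K / 2 * s\<^sup>2\<close>\<close>
  have s: "\<bar>s\<bar> \<le> r" "s \<noteq> 0"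
    using assms False by (auto simp: s_def field_simps abs_divide)
  \<comment> \<open>\<open>Taylor\<close> expects all derivatives as one family indexed by their
    order; only orders 0, 1 and 2 matter.\<close>
  define df where "df = (\<lambda>m. if m = 0 then \<phi> else if m = Suc 0 then \<phi>' else \<phi>'')"
  have "\<exists>t. (if s < 0 then s < t \<and> t < 0 else 0 < t \<and> t < s) \<and>
     \<phi> s = (\<Sum>m<2. (df m 0 / fact m) * (s - 0) ^ m) + (df 2 t / fact 2) * (s - 0) ^ 2"
  proof (rule Taylor[of 2 df \<phi> "-r" r 0 s])
    show "\<forall>m t. m < 2 \<and> -r \<le> t \<and> t \<le> r \<longrightarrow> DERIV (df m) t :> df (Suc m) t"
    proof (intro allI impI)
      fix m t assume "m < (2::nat) \<and> -r \<le> t \<and> t \<le> r"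
      then have "m = 0 \<or> m = Suc 0" "\<bar>t\<bar> \<le> r" by auto
      then show "DERIV (df m) t :> df (Suc m) t" using d1 d2 by (auto simp: df_def)
    qed
  qed (use s assms(1) in \<open>auto simp: df_def\<close>)
  then obtain t where *: "if s < 0 then s < t \<and> t < 0 else 0 < t \<and> t < s"
     "\<phi> s = (\<Sum>m<2. (df m 0 / fact m) * (s - 0) ^ m) + (df 2 t / fact 2) * (s - 0) ^ 2"
    by blast
  have t: "\<bar>t\<bar> \<le> r" using *(1) s(1) by (auto split: if_splits)
  have e: "\<phi> s = \<phi> 0 + \<phi>' 0 * s + \<phi>'' t / 2 * s\<^sup>2"
    using *(2) by (simp add: df_def lessThan_Suc numeral_2_eq_2)
  have "\<phi>'' t / 2 * s\<^sup>2 \<le> K / 2 * s\<^sup>2"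
    using bound(1)[OF t] by (intro mult_right_mono) auto
  then have "0 \<le> \<phi> 0 + \<phi>' 0 * s + K / 2 * s\<^sup>2"
    using e nonneg[OF s(1)] by linarith
  then show ?thesis using assms(2)
    by (simp add: s_def power2_eq_square field_simps)
qed

text \<open>The interval estimate is applied to m - h along the segment through \<open>y\<close> in
  direction \<open>u\<close>. Compactness of a closed ball around \<open>y0\<close> makes the
  constants independent of \<open>y\<close>.\<close>

lemma bounded_above_partial_derivative_bound:
  fixes h :: "'a::euclidean_space \<Rightarrow> real"
  assumes "open W" "y0 \<in> W" "Ck_on 2 h W" "\<And>y. y \<in> W \<Longrightarrow> h y \<le> m" "norm u = 1"
  shows "\<exists>K>0. \<exists>r>0. \<forall>y\<in>ball y0 r. (frechet_derivative h (at y) u)\<^sup>2 \<le> K * (m - h y)"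
proof -
  define D where "D = (\<lambda>y. frechet_derivative h (at y) u)"
  define D2 where "D2 = (\<lambda>y. frechet_derivative D (at y) u)"
  have h': "(h has_derivative frechet_derivative h (at y)) (at y)" if "y \<in> W" for y
    using assms(3) that frechet_derivative_works by (auto simp: numeral_2_eq_2)
  have D': "(D has_derivative frechet_derivative D (at y)) (at y)" if "y \<in> W" for y
  proof -
    have "D differentiable at y" using assms(3) that by (simp add: numeral_2_eq_2 D_def)
    then show ?thesis using frechet_derivative_works by blast
  qed
  have cD: "continuous_on W D"
    by (intro continuous_at_imp_continuous_on ballI has_derivative_continuous[OF D'])
  have cD2: "continuous_on W D2"
    using assms(3) by (auto simp: numeral_2_eq_2 D2_def D_def)
  obtain R where R: "R > 0" "cball y0 R \<subseteq> W"
    using assms(1,2) open_contains_cball by blast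
  have "compact (D ` cball y0 R)" "compact (D2 ` cball y0 R)"
    using cD cD2 R(2) by (auto intro!: compact_continuous_image intro: continuous_on_subset)
  then obtain B1 B2 where B: "\<And>y. y \<in> cball y0 R \<Longrightarrow> \<bar>D y\<bar> \<le> B1" "\<And>y. y \<in> cball y0 R \<Longrightarrow> \<bar>D2 y\<bar> \<le> B2"
    by (metis (no_types, lifting) compact_imp_bounded bounded_iff imageI real_norm_def)
  \<comment> \<open>Half of \<open>R\<close>, so that every segment of half-length \<open>r\<close>
    centred in \<open>ball y0 r\<close> stays in \<open>cball y0 R\<close>. In \<open>K\<close>, the
    first summand bounds the second derivative, the second gives \<open>B1 \<le> K * r\<close>, and
    1 ensures positivity.\<close>
  define r where "r = R / 2"
  define K where "K = \<bar>B2\<bar> + \<bar>B1\<bar> / r + 1"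
  have r: "r > 0" using R by (simp add: r_def)
  have "\<bar>B1\<bar> / r \<ge> 0" using r by simp
  then have K: "K > 0" "B2 \<le> K" unfolding K_def by linarith+
  have "K * r = \<bar>B2\<bar> * r + \<bar>B1\<bar> + r" using r by (simp add: K_def field_simps)
  then have K1: "B1 \<le> K * r" using mult_nonneg_nonneg[of "\<bar>B2\<bar>" r] r by linarith
  have "(D y)\<^sup>2 \<le> 2 * K * (m - h y)" if y: "y \<in> ball y0 r" for y
  proof -
    have inW: "y + s *\<^sub>R u \<in> cball y0 R" if "\<bar>s\<bar> \<le> r" for s
    proof -
      have "dist y0 (y + s *\<^sub>R u) \<le> dist y0 y + dist y (y + s *\<^sub>R u)" by (rule dist_triangle)
      also have "\<dots> \<le> r + r"
        using y that assms(5) by (intro add_mono) (simp_all add: dist_norm)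
      finally show ?thesis by (simp add: r_def)
    qed
    have line: "((\<lambda>s. F (y + s *\<^sub>R u)) has_real_derivative frechet_derivative F (at (y + s *\<^sub>R u)) u) (at s)"
      if "(F has_derivative frechet_derivative F (at (y + s *\<^sub>R u))) (at (y + s *\<^sub>R u))" for F :: "'a \<Rightarrow> real" and s
    proof -
      have "((\<lambda>s. F (y + s *\<^sub>R u)) has_derivative (\<lambda>t. frechet_derivative F (at (y + s *\<^sub>R u)) (t *\<^sub>R u))) (at s)"
      proof -
        have "((\<lambda>s. y + s *\<^sub>R u) has_derivative (\<lambda>t. t *\<^sub>R u)) (at s)"
          by (auto intro!: derivative_eq_intros)
        from has_derivative_compose[OF this that] show ?thesis .
      qed
      moreover have "linear (frechet_derivative F (at (y + s *\<^sub>R u)))"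
        using that by (rule has_derivative_linear)
      then have "(\<lambda>t. frechet_derivative F (at (y + s *\<^sub>R u)) (t *\<^sub>R u))
          = (*) (frechet_derivative F (at (y + s *\<^sub>R u)) u)"
        by (auto simp: fun_eq_iff linear_cmul)
      ultimately show ?thesis
        unfolding has_field_derivative_def by metis
    qed
    \<comment> \<open>The zero multiple of \<open>u\<close> is kept so that the claim is literally
      the interval estimate at parameter 0.\<close>
    have "(- D (y + 0 *\<^sub>R u))\<^sup>2 \<le> 2 * K * (m - h (y + 0 *\<^sub>R u))"
    proof (rule interval_nonneg_derivative_bound[where \<phi> = "\<lambda>s. m - h (y + s *\<^sub>R u)"
          and \<phi>' = "\<lambda>s. - D (y + s *\<^sub>R u)" and \<phi>'' = "\<lambda>s. - D2 (y + s *\<^sub>R u)", OF r K(1)])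
      fix s assume s: "\<bar>s\<bar> \<le> r"
      note * = inW[OF s] subsetD[OF R(2) inW[OF s]]
      show "((\<lambda>s. m - h (y + s *\<^sub>R u)) has_real_derivative - D (y + s *\<^sub>R u)) (at s)"
        using DERIV_diff[OF DERIV_const line[OF h'[OF *(2)]], of m] by (simp add: D_def)
      show "((\<lambda>s. - D (y + s *\<^sub>R u)) has_real_derivative - D2 (y + s *\<^sub>R u)) (at s)"
        using DERIV_minus[OF line[OF D'[OF *(2)]]] by (simp add: D2_def)
      show "0 \<le> m - h (y + s *\<^sub>R u)" using assms(4)[OF *(2)] by simp
      show "\<bar>- D2 (y + s *\<^sub>R u)\<bar> \<le> K" using B(2)[OF *(1)] K by simp
    next
      show "\<bar>- D (y + 0 *\<^sub>R u)\<bar> \<le> K * r" using B(1)[of y] inW[of 0] K1 r by simp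
    qed
    then show ?thesis by simp
  qed
  then show ?thesis using r K by (intro exI[of _ "2 * K"] conjI exI[of _ r]) (auto simp: D_def)
qed

lemma linear_axis_expansion:
  fixes F :: "real ^ 'n \<Rightarrow> real"
  assumes "linear F"
  shows "F \<eta> = (\<Sum>j\<in>UNIV. \<eta> $ j * F (axis j 1))"
proof -
  have "F \<eta> = F (\<Sum>j\<in>UNIV. (\<eta> $ j) *\<^sub>R axis j 1)"
    using basis_expansion[of \<eta>] by (simp add: scalar_mult_eq_scaleR)
  then show ?thesis using assms by (simp add: linear_sum linear_cmul)
qed

section \<open>Tangent vectors in a chart\<close>

lemma tangent_space_transition:
  "v \<in> tangent_space A x \<Longrightarrow> c \<in> A \<Longrightarrow> d \<in> A \<Longrightarrow> x \<in> fst c \<Longrightarrow> x \<in> fst d \<Longrightarrow>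
    v d = transition_deriv c d x (v c)"
  unfolding tangent_space_def by blast

lemma tangent_space_outside: "v \<in> tangent_space A x \<Longrightarrow> \<not> (d \<in> A \<and> x \<in> fst d) \<Longrightarrow> v d = 0"
  unfolding tangent_space_def by blast

context smooth_manifold_with_boundary
begin

section \<open>Charts, and uniqueness of derivatives within chart images\<close>

lemma fst_chart_subset: "c \<in> A \<Longrightarrow> fst c \<subseteq> topspace M"
  using covering by blast

lemma chart_point_in_topspace: "c \<in> A \<Longrightarrow> x \<in> fst c \<Longrightarrow> x \<in> topspace M"
  using covering by blast

lemma openin_chart: "c \<in> A \<Longrightarrow> openin M (fst c)"
  using charts is_chart_def by blast

lemma chart_homeomorphic:
  "c \<in> A \<Longrightarrow> homeomorphic_map (subtopology M (fst c)) (top_of_set (chart_image c)) (snd c)"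
  using charts is_chart_def by blast

lemma chart_inv_chart: "c \<in> A \<Longrightarrow> x \<in> fst c \<Longrightarrow> chart_inv c (snd c x) = x"
  using chart_homeomorphic[of c] fst_chart_subset[of c]
  by (auto simp: chart_inv_def homeomorphic_eq_everything_map inf.absorb2 intro!: inv_into_f_f)

lemma openin_chart_restrict:
  assumes "c \<in> A" "openin M U"
  shows "openin (top_of_set (chart_image c)) (snd c ` (fst c \<inter> U))"
proof -
  have "openin (subtopology M (fst c)) (fst c \<inter> U)"
    using assms(2) by (auto simp: openin_subtopology)
  then show ?thesis
    using homeomorphic_imp_open_map[OF chart_homeomorphic[OF assms(1)]]
    by (auto simp: open_map_def)
qed

text \<open>The set is relatively open in the chart image, hence open in Euclidean space or in a
  half-space. Either way small steps along all basis vectors remain in it. This is what makes the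
  chart computations below well defined at boundary points too.\<close>

lemma chart_restrict_derivative_unique:
  assumes c: "c \<in> A" and U: "openin M U" and x: "x \<in> fst c \<inter> U"
    and D: "(h has_derivative D) (at (snd c x) within snd c ` (fst c \<inter> U))"
    and D': "(h has_derivative D') (at (snd c x) within snd c ` (fst c \<inter> U))"
  shows "D = D'"
proof (rule frechet_derivative_unique_within[OF D D'])
  let ?S = "snd c ` (fst c \<inter> U)"
  fix i :: "real^'n" and e :: real
  assume i: "i \<in> Basis" and e: "e > 0"
  have S: "openin (top_of_set (chart_image c)) ?S" using openin_chart_restrict[OF c U] .
  consider "open ?S" | k where "openin (top_of_set (half_space k)) ?S"
    using charts[OF c] S by (auto simp: is_chart_def intro: openin_open_trans openin_trans)
  then show "\<exists>d. 0 < \<bar>d\<bar> \<and> \<bar>d\<bar> < e \<and> snd c x + d *\<^sub>R i \<in> ?S"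
  proof cases
    case 1
    then obtain r where r: "r > 0" "ball (snd c x) r \<subseteq> ?S"
      using x open_contains_ball by blast
    have "snd c x + (min r e / 2) *\<^sub>R i \<in> ball (snd c x) r"
      using r(1) e i by (simp add: dist_norm)
    then show ?thesis using r e by (intro exI[of _ "min r e / 2"]) auto
  next
    case 2
    then show ?thesis using half_space_forward_step x i e by blast
  qed
qed

section \<open>Transition derivatives and their cocycle identity\<close>

lemma transition_chart: "c \<in> A \<Longrightarrow> x \<in> fst c \<Longrightarrow> transition c d (snd c x) = snd d x"
  by (simp add: transition_def chart_inv_chart)

lemma transition_has_derivative:
  assumes "c \<in> A" "d \<in> A" "x \<in> fst c" "x \<in> fst d"
  shows "(transition c d has_derivative transition_deriv c d x)
           (at (snd c x) within snd c ` (fst c \<inter> fst d))"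
  unfolding transition_deriv_def
  by (rule smooth_on_imp_has_derivative[OF compatible]) (use assms in auto)

lemma transition_deriv_linear:
  assumes "c \<in> A" "d \<in> A" "x \<in> fst c" "x \<in> fst d"
  shows "linear (transition_deriv c d x)"
  using transition_has_derivative[OF assms] by (rule has_derivative_linear)

text \<open>Chain rule on the triple overlap, where both sides are derivatives of
  \<open>transition c e\<close>; they agree by uniqueness within the image of that overlap.\<close>

lemma transition_deriv_compose:
  assumes "c \<in> A" "d \<in> A" "e \<in> A" "x \<in> fst c" "x \<in> fst d" "x \<in> fst e"
  shows "transition_deriv d e x (transition_deriv c d x \<xi>) = transition_deriv c e x \<xi>"
proof -
  let ?U = "fst d \<inter> fst e"
  let ?S = "snd c ` (fst c \<inter> ?U)"
  have 1: "(transition c d has_derivative transition_deriv c d x) (at (snd c x) within ?S)"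
    by (rule has_derivative_subset[OF transition_has_derivative]) (use assms in auto)
  have "(transition d e has_derivative transition_deriv d e x)
      (at (transition c d (snd c x)) within transition c d ` ?S)"
    unfolding transition_chart[OF assms(1,4)]
    by (rule has_derivative_subset[OF transition_has_derivative])
      (use assms in \<open>auto simp: transition_chart\<close>)
  from diff_chain_within[OF 1 this]
  have "(transition c e has_derivative transition_deriv d e x \<circ> transition_deriv c d x)
      (at (snd c x) within ?S)"
    by (rule has_derivative_transform_within_inter[where W = UNIV])
      (use assms in \<open>auto simp: transition_chart\<close>)
  moreover have "(transition c e has_derivative transition_deriv c e x) (at (snd c x) within ?S)"
    by (rule has_derivative_subset[OF transition_has_derivative]) (use assms in auto)
  ultimately have "transition_deriv d e x \<circ> transition_deriv c d x = transition_deriv c e x"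
    by (rule chart_restrict_derivative_unique[rotated 3])
      (use assms in \<open>auto intro!: openin_Int openin_chart\<close>)
  then show ?thesis by (metis comp_apply)
qed

text \<open>On the chart image \<open>transition c c\<close> is the identity, and the derivative
  there is unique.\<close>

lemma transition_deriv_self:
  assumes "c \<in> A" "x \<in> fst c"
  shows "transition_deriv c c x \<xi> = \<xi>"
proof -
  have "((\<lambda>y. y) has_derivative transition_deriv c c x) (at (snd c x) within snd c ` (fst c \<inter> fst c))"
    by (rule has_derivative_transform_within_inter[where W = UNIV, OF transition_has_derivative])
      (use assms in \<open>auto simp: transition_chart\<close>)
  then have "transition_deriv c c x = (\<lambda>y. y)"
    by (rule chart_restrict_derivative_unique[rotated 3])
      (use assms openin_chart in auto)
  then show ?thesis by metis
qed

section \<open>Coordinates on the tangent space, and the differential\<close>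

text \<open>Inverse of the coordinate map taking a tangent vector \<open>v\<close> to
  \<open>v c\<close>, extending \<open>coord_vector\<close> to arbitrary components. The default 0
  follows the normalization in \<open>tangent_space\<close>.\<close>

definition chart_vector :: "('a, 'n) chart \<Rightarrow> 'a \<Rightarrow> real ^ 'n \<Rightarrow> ('a, 'n) tangent" where
  "chart_vector c x \<xi> = (\<lambda>d. if d \<in> A \<and> x \<in> fst d then transition_deriv c d x \<xi> else 0)"

lemma chart_vector_axis: "chart_vector c x (axis i 1) = coord_vector A c i x"
  by (simp add: chart_vector_def coord_vector_def)

context
  fixes c x
  assumes c: "c \<in> A" and x: "x \<in> fst c"
begin

lemma chart_vector_self: "chart_vector c x \<xi> c = \<xi>"
  using c x by (simp add: chart_vector_def transition_deriv_self)

text \<open>The compatibility demanded of a tangent vector is exactly the cocycle identity.\<close>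

lemma chart_vector_tangent: "chart_vector c x \<xi> \<in> tangent_space A x"
  using c x by (auto simp: tangent_space_def chart_vector_def transition_deriv_compose)

lemma tangent_eq_chart_vector:
  assumes v: "v \<in> tangent_space A x"
  shows "v = chart_vector c x (v c)"
proof
  fix d
  show "v d = chart_vector c x (v c) d"
  proof (cases "d \<in> A \<and> x \<in> fst d")
    case True
    then have "v d = transition_deriv c d x (v c)"
      using tangent_space_transition[OF v c _ x] by blast
    then show ?thesis unfolding chart_vector_def if_P[OF True] .
  next
    case False
    then show ?thesis
      unfolding chart_vector_def if_not_P[OF False] by (rule tangent_space_outside[OF v])
  qed
qed

lemma chart_vector_lincomb:
  "chart_vector c x (a *\<^sub>R \<xi> + b *\<^sub>R \<eta>) = (\<lambda>d. a *\<^sub>R chart_vector c x \<xi> d + b *\<^sub>R chart_vector c x \<eta> d)"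
  using linear_add[OF transition_deriv_linear[OF c _ x]] linear_cmul[OF transition_deriv_linear[OF c _ x]]
  by (auto simp: chart_vector_def)

text \<open>The description by \<open>THE\<close> is meaningful once all charts give the same value.
  They do by the chain rule, since on an overlap \<open>f \<circ> chart_inv c\<close> is
  \<open>f \<circ> chart_inv d\<close> after \<open>transition c d\<close>.\<close>

lemma differential_eq_chart_derivative:
  assumes f: "smooth_function A f" and v: "v \<in> tangent_space A x"
  shows "differential A f x v =
    frechet_derivative (f \<circ> chart_inv c) (at (snd c x) within chart_image c) (v c)"
proof -
  let ?D = "\<lambda>d. frechet_derivative (f \<circ> chart_inv d) (at (snd d x) within chart_image d)"
  have D: "(f \<circ> chart_inv d has_derivative ?D d) (at (snd d x) within chart_image d)"
    if "d \<in> A" "x \<in> fst d" for d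
    by (rule smooth_on_imp_has_derivative)
      (use f that in \<open>auto simp: smooth_function_def chart_image_def\<close>)
  have "?D d (v d) = ?D c (v c)" if d: "d \<in> A" "x \<in> fst d" for d
  proof -
    let ?S = "snd c ` (fst c \<inter> fst d)"
    have "(f \<circ> chart_inv d has_derivative ?D d)
        (at (transition c d (snd c x)) within transition c d ` ?S)"
      unfolding transition_chart[OF c x]
      by (rule has_derivative_subset[OF D[OF d]])
        (use c in \<open>auto simp: transition_chart chart_image_def\<close>)
    from diff_chain_within[OF transition_has_derivative[OF c d(1) x d(2)] this]
    have "(f \<circ> chart_inv c has_derivative ?D d \<circ> transition_deriv c d x) (at (snd c x) within ?S)"
      by (rule has_derivative_transform_within_inter[where W = UNIV])
        (use c x d in \<open>auto simp: transition_chart chart_inv_chart\<close>)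
    moreover have "(f \<circ> chart_inv c has_derivative ?D c) (at (snd c x) within ?S)"
      by (rule has_derivative_subset[OF D[OF c x]]) (auto simp: chart_image_def)
    ultimately have "?D d \<circ> transition_deriv c d x = ?D c"
      by (rule chart_restrict_derivative_unique[rotated 3]) (use c x d openin_chart in auto)
    moreover have "v d = transition_deriv c d x (v c)"
      by (rule tangent_space_transition[OF v c d(1) x d(2)])
    ultimately show ?thesis by (metis comp_apply)
  qed
  then have "\<forall>d\<in>A. x \<in> fst d \<longrightarrow> ?D c (v c) = ?D d (v d)" by metis
  then show ?thesis
    unfolding differential_def using c x by (intro the_equality) blast+
qed

end

end

section \<open>The metric and the gradient in a chart\<close>

context riemannian_manifold_with_boundary
begin

text \<open>Pulling \<open>g\<close> back to \<open>real ^ 'n\<close> turns it into an inner product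
  on a fixed vector space, where linear algebra and compactness apply.\<close>

definition chart_metric :: "('a, 'n) chart \<Rightarrow> 'a \<Rightarrow> real ^ 'n \<Rightarrow> real ^ 'n \<Rightarrow> real" where
  "chart_metric c x \<xi> \<eta> = g x (chart_vector c x \<xi>) (chart_vector c x \<eta>)"

context
  fixes c x
  assumes c: "c \<in> A" and x: "x \<in> fst c"
begin

lemma chart_metric_sym: "chart_metric c x \<xi> \<eta> = chart_metric c x \<eta> \<xi>"
  unfolding chart_metric_def
  by (rule metric_sym) (use chart_point_in_topspace[OF c x] chart_vector_tangent[OF c x] in auto)

lemma linear_chart_metric_left: "linear (\<lambda>\<xi>. chart_metric c x \<xi> \<eta>)"
proof -
  have "chart_metric c x (a *\<^sub>R \<xi> + b *\<^sub>R \<zeta>) \<eta> = a * chart_metric c x \<xi> \<eta> + b * chart_metric c x \<zeta> \<eta>"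
    for a b \<xi> \<zeta>
    unfolding chart_metric_def chart_vector_lincomb[OF c x]
    by (rule metric_linear) (use chart_point_in_topspace[OF c x] chart_vector_tangent[OF c x] in auto)
  \<comment> \<open>Coefficients 1 and 1 give additivity; second coefficient 0 gives
    homogeneity.\<close>
  from this[of 1 _ 1] this[of _ _ 0] show ?thesis by (intro linearI) auto
qed

lemma linear_chart_metric_right: "linear (chart_metric c x \<xi>)"
proof -
  have "chart_metric c x \<xi> = (\<lambda>\<eta>. chart_metric c x \<eta> \<xi>)" using chart_metric_sym by blast
  then show ?thesis using linear_chart_metric_left by simp
qed

lemma chart_metric_pos: "\<xi> \<noteq> 0 \<Longrightarrow> 0 < chart_metric c x \<xi> \<xi>"
  unfolding chart_metric_def
  using chart_vector_self[OF c x, of \<xi>]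
  by (intro metric_pos chart_point_in_topspace[OF c x] chart_vector_tangent[OF c x]) auto

text \<open>Riesz representation in coordinates: positive definiteness makes the Gram map injective,
  hence surjective in finite dimension, which yields \<xi>. Positivity on the difference of two
  representing vectors gives the uniqueness that \<open>THE\<close> needs.\<close>

lemma gradient_eq_chart_vector:
  assumes f: "smooth_function A f"
  obtains \<xi> where "gradient A g f x = chart_vector c x \<xi>"
    "\<And>\<eta>. chart_metric c x \<xi> \<eta> =
       frechet_derivative (f \<circ> chart_inv c) (at (snd c x) within chart_image c) \<eta>"
proof -
  let ?D = "frechet_derivative (f \<circ> chart_inv c) (at (snd c x) within chart_image c)"
  have D: "linear ?D"
    by (rule has_derivative_linear, rule smooth_on_imp_has_derivative)
      (use f c x in \<open>auto simp: smooth_function_def chart_image_def\<close>)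
  \<comment> \<open>The Gram matrix of the metric applied to \<xi>.\<close>
  define T where "T = (\<lambda>\<xi>. \<chi> j. chart_metric c x \<xi> (axis j 1))"
  have T: "linear T"
    by (intro linearI)
      (simp_all add: T_def vec_eq_iff linear_add[OF linear_chart_metric_left]
        linear_cmul[OF linear_chart_metric_left])
  have "\<xi> = 0" if "T \<xi> = 0" for \<xi>
  proof -
    have "chart_metric c x \<xi> (axis j 1) = 0" for j
      using that by (simp add: T_def vec_eq_iff)
    then have "chart_metric c x \<xi> \<xi> = 0"
      by (simp add: linear_axis_expansion[OF linear_chart_metric_right, of \<xi> \<xi>])
    then show ?thesis using chart_metric_pos by force
  qed
  then have "inj T" using T linear_injective_0 by blast
  then have "surj T" using T linear_injective_imp_surjective by blast
  then obtain \<xi> where \<xi>: "T \<xi> = (\<chi> j. ?D (axis j 1))" by (metis surjD)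
  have eq: "chart_metric c x \<xi> \<eta> = ?D \<eta>" for \<eta>
    using \<xi> by (simp add: linear_axis_expansion[OF linear_chart_metric_right, of \<xi> \<eta>]
        linear_axis_expansion[OF D, of \<eta>] T_def vec_eq_iff)
  have "gradient A g f x = chart_vector c x \<xi>"
    unfolding gradient_def
  proof (rule the_equality, intro conjI ballI)
    show "chart_vector c x \<xi> \<in> tangent_space A x" by (rule chart_vector_tangent[OF c x])
    fix v assume v: "v \<in> tangent_space A x"
    have "g x (chart_vector c x \<xi>) v = chart_metric c x \<xi> (v c)"
      unfolding chart_metric_def using tangent_eq_chart_vector[OF c x v] by simp
    then show "g x (chart_vector c x \<xi>) v = differential A f x v"
      using eq differential_eq_chart_derivative[OF c x f v] by simp
  next
    fix w assume "w \<in> tangent_space A x \<and> (\<forall>v\<in>tangent_space A x. g x w v = differential A f x v)"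
    then have w: "w \<in> tangent_space A x" "\<And>v. v \<in> tangent_space A x \<Longrightarrow> g x w v = differential A f x v"
      by auto
    have "chart_metric c x (w c) \<eta> = ?D \<eta>" for \<eta>
      using w(2)[OF chart_vector_tangent[OF c x]] tangent_eq_chart_vector[OF c x w(1)]
        differential_eq_chart_derivative[OF c x f chart_vector_tangent[OF c x]]
      by (simp add: chart_metric_def chart_vector_self[OF c x])
    then have "chart_metric c x (w c - \<xi>) (w c - \<xi>) = 0"
      using eq linear_diff[OF linear_chart_metric_left] by simp
    then have "w c = \<xi>" using chart_metric_pos[of "w c - \<xi>"] by fastforce
    then show "w = chart_vector c x \<xi>" using tangent_eq_chart_vector[OF c x w(1)] by simp
  qed
  with eq show thesis by (rule that[rotated])
qed

text \<open>The squared norm \<open>G\<close> of the gradient equals the Euclidean product of \<xi>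
  with the vector \<open>L\<close> of partial derivatives. Cauchy-Schwarz and ellipticity give
  \<open>\<mu> * G\<^sup>2 \<le> G * (norm L)\<^sup>2\<close>, and one factor \<open>G\<close>
  cancels.\<close>

lemma gradient_norm_le:
  assumes f: "smooth_function A f" and "\<mu> > 0"
    and elliptic: "\<And>\<zeta>. \<mu> * (norm \<zeta>)\<^sup>2 \<le> chart_metric c x \<zeta> \<zeta>"
  shows "(metric_norm g x (gradient A g f x))\<^sup>2 \<le>
    (\<Sum>i\<in>UNIV. (frechet_derivative (f \<circ> chart_inv c) (at (snd c x) within chart_image c) (axis i 1))\<^sup>2) / \<mu>"
proof -
  let ?D = "frechet_derivative (f \<circ> chart_inv c) (at (snd c x) within chart_image c)"
  obtain \<xi> where \<xi>: "gradient A g f x = chart_vector c x \<xi>" "\<And>\<eta>. chart_metric c x \<xi> \<eta> = ?D \<eta>"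
    using gradient_eq_chart_vector[OF f] by blast
  define G where "G = chart_metric c x \<xi> \<xi>"
  define L :: "real ^ 'n" where "L = (\<chi> i. ?D (axis i 1))"
  have "0 \<le> \<mu> * (norm \<xi>)\<^sup>2" using \<open>\<mu> > 0\<close> by simp
  then have G0: "G \<ge> 0" using elliptic[of \<xi>] unfolding G_def by linarith
  \<comment> \<open>Squaring undoes the square root in \<open>metric_norm\<close> because
    \<open>G\<close> is nonnegative.\<close>
  then have norm_eq: "(metric_norm g x (gradient A g f x))\<^sup>2 = G"
    by (simp add: metric_norm_def \<xi>(1) G_def chart_metric_def)
  have "G = \<xi> \<bullet> L"
    using linear_axis_expansion[OF linear_chart_metric_right, of \<xi> \<xi>] \<xi>(2)
    by (simp add: G_def L_def inner_vec_def)
  then have "G\<^sup>2 \<le> (norm \<xi>)\<^sup>2 * (norm L)\<^sup>2"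
    using Cauchy_Schwarz_ineq[of \<xi> L] by (simp add: power2_norm_eq_inner)
  then have "\<mu> * G\<^sup>2 \<le> (\<mu> * (norm \<xi>)\<^sup>2) * (norm L)\<^sup>2"
    using \<open>\<mu> > 0\<close> by (simp add: mult.assoc)
  also have "\<dots> \<le> G * (norm L)\<^sup>2"
    using elliptic[of \<xi>] unfolding G_def by (intro mult_right_mono) auto
  finally have "G * (\<mu> * G) \<le> G * (norm L)\<^sup>2" by (simp add: power2_eq_square mult_ac)
  then have "\<mu> * G \<le> (norm L)\<^sup>2" using G0 by (cases "G = 0") auto
  then have "G \<le> (norm L)\<^sup>2 / \<mu>" using \<open>\<mu> > 0\<close> by (simp add: field_simps)
  moreover have "(norm L)\<^sup>2 = (\<Sum>i\<in>UNIV. (?D (axis i 1))\<^sup>2)"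
    unfolding power2_norm_eq_inner inner_vec_def by (simp add: L_def power2_eq_square)
  ultimately show ?thesis using norm_eq by simp
qed

end

section \<open>Uniform ellipticity on compact sets, and interior points of chart images\<close>

lemma chart_inv_in: "y \<in> chart_image c \<Longrightarrow> chart_inv c y \<in> fst c"
  unfolding chart_inv_def chart_image_def by (rule inv_into_into)

text \<open>\<mu> is the minimum of the quadratic form over the compact product of \<open>K\<close>
  with the unit sphere, positive because it is attained; scaling by the norm extends the bound to
  all vectors.\<close>

lemma chart_metric_uniformly_elliptic:
  assumes c: "c \<in> A" and K: "compact K" "K \<subseteq> chart_image c"
  shows "\<exists>\<mu>>0. \<forall>y\<in>K. \<forall>\<zeta>. \<mu> * (norm \<zeta>)\<^sup>2 \<le> chart_metric c (chart_inv c y) \<zeta> \<zeta>"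
proof (cases "K = {}")
  case True then show ?thesis by (auto intro: exI[of _ 1])
next
  case False
  let ?g = "\<lambda>i j y. chart_metric c (chart_inv c y) (axis i 1) (axis j 1)"
  let ?S = "sphere (0::real^'n) 1"
  \<comment> \<open>Written through the metric coefficients, whose continuity comes from
    \<open>metric_smooth\<close>, so that joint continuity in point and vector is visible.\<close>
  define F where "F = (\<lambda>(y, \<zeta>). \<Sum>i\<in>UNIV. \<zeta> $ i * (\<Sum>j\<in>UNIV. \<zeta> $ j * ?g i j y))"
  have F: "F (y, \<zeta>) = chart_metric c (chart_inv c y) \<zeta> \<zeta>" if "y \<in> K" for y \<zeta>
  proof -
    have "chart_inv c y \<in> fst c" using that K chart_inv_in by blast
    note lin = linear_chart_metric_left[OF c this] linear_chart_metric_right[OF c this]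
    show ?thesis
      unfolding F_def
      by (simp add: linear_axis_expansion[OF lin(1), of \<zeta> \<zeta>]
          linear_axis_expansion[OF lin(2), of "axis _ 1" \<zeta>])
  qed
  have "continuous_on K (?g i j)" for i j
    using continuous_on_subset[OF smooth_on_imp_continuous_on[OF metric_smooth[OF c]] K(2), of i j]
    by (simp add: chart_metric_def chart_vector_axis o_def)
  then have "continuous_on (K \<times> ?S) (\<lambda>z. ?g i j (fst z))" for i j
    by (rule continuous_on_compose2[where g = "?g i j"]) (auto intro: continuous_intros)
  then have "continuous_on (K \<times> ?S) F"
    unfolding F_def case_prod_unfold by (intro continuous_intros)
  moreover have "compact (K \<times> ?S)" "K \<times> ?S \<noteq> {}" using K(1) False by (auto intro: compact_Times)
  ultimately obtain y0 \<zeta>0 where m: "y0 \<in> K" "\<zeta>0 \<in> ?S"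
    "\<And>y \<zeta>. y \<in> K \<Longrightarrow> \<zeta> \<in> ?S \<Longrightarrow> F (y0, \<zeta>0) \<le> F (y, \<zeta>)"
    using continuous_attains_inf[of "K \<times> ?S" F] by (metis mem_Times_iff prod.collapse fst_conv snd_conv)
  define \<mu> where "\<mu> = F (y0, \<zeta>0)"
  have "\<zeta>0 \<noteq> 0" using m(2) by auto
  then have "\<mu> > 0"
    unfolding \<mu>_def F[OF m(1)] 
    by (intro chart_metric_pos c chart_inv_in subsetD[OF K(2) m(1)])
  moreover have "\<mu> * (norm \<zeta>)\<^sup>2 \<le> chart_metric c (chart_inv c y) \<zeta> \<zeta>" if y: "y \<in> K" for y \<zeta>
  proof (cases "\<zeta> = 0")
    case True
    have "chart_inv c y \<in> fst c" using y K chart_inv_in by blast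
    then show ?thesis using True linear_0[OF linear_chart_metric_right[OF c]] by simp
  next
    case False
    have x: "chart_inv c y \<in> fst c" using y K chart_inv_in by blast
    define u where "u = (1 / norm \<zeta>) *\<^sub>R \<zeta>"
    have u: "u \<in> ?S" "\<zeta> = norm \<zeta> *\<^sub>R u" using False by (auto simp: u_def)
    have "chart_metric c (chart_inv c y) (norm \<zeta> *\<^sub>R u) (norm \<zeta> *\<^sub>R u)
        = (norm \<zeta>)\<^sup>2 * chart_metric c (chart_inv c y) u u"
      by (simp add: linear_cmul[OF linear_chart_metric_left[OF c x]]
          linear_cmul[OF linear_chart_metric_right[OF c x]] power2_eq_square)
    moreover have "\<mu> \<le> chart_metric c (chart_inv c y) u u"
      using m(3)[OF y u(1)] F[OF y] by (simp add: \<mu>_def)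
    ultimately show ?thesis using u(2) by (metis mult.commute mult_left_mono zero_le_power2)
  qed
  ultimately show ?thesis by blast
qed

text \<open>In a half-space chart a point off the boundary has positive k-th coordinate, for
  otherwise \<open>c\<close> itself would witness that it is a boundary point. So near it the
  half-space is no constraint.\<close>

lemma chart_image_interior:
  assumes c: "c \<in> A" and p: "p \<in> fst c" "p \<notin> manifold_boundary A"
  shows "snd c p \<in> interior (chart_image c)"
proof -
  have y: "snd c p \<in> chart_image c" using p by (simp add: chart_image_def)
  consider "open (chart_image c)" | k where "openin (top_of_set (half_space k)) (chart_image c)"
    using charts[OF c] by (auto simp: is_chart_def)
  then show ?thesis
  proof cases
    case 1 then show ?thesis using y by (simp add: interior_open)
  next
    case 2
    then obtain T where T: "open T" "chart_image c = half_space k \<inter> T"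
      by (auto simp: openin_open)
    have "snd c p $ k \<noteq> 0" using 2 c p by (auto simp: manifold_boundary_def)
    then have "snd c p \<in> T \<inter> {y. 0 < y $ k}" using y T by (auto simp: half_space_def)
    moreover have "open (T \<inter> {y. 0 < y $ k})"
      using T(1) by (intro open_Int open_Collect_less continuous_intros)
    moreover have "T \<inter> {y. 0 < y $ k} \<subseteq> chart_image c"
      unfolding T(2) half_space_def by auto
    ultimately show ?thesis by (intro interiorI)
  qed
qed

section \<open>The estimate near a single maximum point\<close>

text \<open>Combines the bounds on the partial derivatives with ellipticity in one chart around
  \<open>p\<close>. The clause \<open>m - f x \<le> 1\<close> prepares the later change of
  exponent.\<close>

lemma gradient_bound_near_maximum:
  assumes f: "smooth_function A f" and le: "\<And>x. x \<in> topspace M \<Longrightarrow> f x \<le> m"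
    and p: "p \<in> topspace M" "f p = m" "p \<notin> manifold_boundary A"
  shows "\<exists>U C. openin M U \<and> p \<in> U \<and> C \<ge> 0 \<and>
    (\<forall>x\<in>U. m - f x \<le> 1 \<and> (metric_norm g x (gradient A g f x))\<^sup>2 \<le> C * (m - f x))"
proof -
  obtain c where c: "c \<in> A" "p \<in> fst c" using p(1) covering by blast
  define y0 where "y0 = snd c p"
  have y0: "y0 \<in> interior (chart_image c)" "y0 \<in> chart_image c"
    using chart_image_interior[OF c p(3)] c(2) by (auto simp: y0_def chart_image_def)
  obtain W h where W: "open W" "y0 \<in> W" "\<forall>k. Ck_on k h W"
      "\<forall>y\<in>chart_image c \<inter> W. h y = (f \<circ> chart_inv c) y"
    by (rule smooth_onE[OF bspec[OF f[unfolded smooth_function_def] c(1)] y0(2)])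
  \<comment> \<open>The extension \<open>h\<close> is known to be at most \<open>m\<close> only
    where it agrees with \<open>f\<close> in coordinates, so its domain is cut down to the interior
    of the chart image.\<close>
  define V where "V = W \<inter> interior (chart_image c)"
  have V: "open V" "y0 \<in> V" "Ck_on 2 h V"
    using W y0 Ck_on_subset[OF spec[OF W(3)]] by (auto simp: V_def)
  have V_img: "V \<subseteq> chart_image c" using interior_subset by (auto simp: V_def)
  have h: "h y = f (chart_inv c y)" if "y \<in> V" for y
    using that W(4) V_img by (auto simp: V_def)
  have h_le: "h y \<le> m" if "y \<in> V" for y
    using le[OF chart_point_in_topspace[OF c(1) chart_inv_in]] h[OF that] that V_img by auto
  have h_diff: "h differentiable at y" if "y \<in> V" for y
    using V(3) that by (simp add: numeral_2_eq_2)
  have "\<exists>K r. K > 0 \<and> r > 0 \<and>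
      (\<forall>y\<in>ball y0 r. (frechet_derivative h (at y) (axis i 1))\<^sup>2 \<le> K * (m - h y))" for i
    using bounded_above_partial_derivative_bound[OF V h_le, where u = "axis i 1"] by auto
  then obtain K r where K: "\<And>i. K i > 0" "\<And>i. r i > 0"
    "\<And>i y. y \<in> ball y0 (r i) \<Longrightarrow> (frechet_derivative h (at y) (axis i 1))\<^sup>2 \<le> K i * (m - h y)"
    by metis
  obtain R where R: "R > 0" "cball y0 R \<subseteq> V" using V open_contains_cball by blast
  obtain \<mu> where \<mu>: "\<mu> > 0"
    "\<And>y \<zeta>. y \<in> cball y0 R \<Longrightarrow> \<mu> * (norm \<zeta>)\<^sup>2 \<le> chart_metric c (chart_inv c y) \<zeta> \<zeta>"
    using chart_metric_uniformly_elliptic[OF c(1) compact_cball subset_trans[OF R(2) V_img]] by blast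
  have "isCont h y0" using h_diff[OF V(2)] by (rule differentiable_imp_continuous_within)
  then obtain \<delta> where \<delta>: "\<delta> > 0" "\<And>y. dist y y0 < \<delta> \<Longrightarrow> dist (h y) (h y0) < 1"
    unfolding continuous_at_eps_delta by (metis zero_less_one)
  have hy0: "h y0 = m" using h[OF V(2)] p(2) c by (simp add: y0_def chart_inv_chart)
  \<comment> \<open>One radius for the ellipticity bound (\<open>R\<close>), for \<open>f\<close>
    being within 1 of \<open>m\<close> (\<delta>), and for each of the finitely many partial
    derivatives (\<open>r i\<close>).\<close>
  define \<rho> where "\<rho> = Min (insert R (insert \<delta> (range r)))"
  have "\<rho> > 0" using R(1) \<delta>(1) K(2) by (auto simp: \<rho>_def)
  moreover have "\<rho> \<le> R" "\<rho> \<le> \<delta>" "\<rho> \<le> r i" for i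
    unfolding \<rho>_def by (intro Min_le; simp)+
  ultimately have \<rho>: "\<rho> > 0" "\<rho> \<le> R" "\<rho> \<le> \<delta>" "\<And>i. \<rho> \<le> r i" by simp_all
  define U where "U = {x \<in> fst c. snd c x \<in> ball y0 \<rho>}"
  have "continuous_map (subtopology M (fst c)) euclidean (snd c)"
    by (rule continuous_map_into_fulltopology[OF
          homeomorphic_imp_continuous_map[OF chart_homeomorphic[OF c(1)]]])
  from openin_continuous_map_preimage[OF this, of "ball y0 \<rho>"]
  have "openin (subtopology M (fst c)) U"
    unfolding topspace_subtopology_subset[OF fst_chart_subset[OF c(1)]] U_def by simp
  then have "openin M U" using openin_chart[OF c(1)] by (rule openin_trans_full)
  moreover have "p \<in> U" using c \<rho> by (simp add: U_def y0_def)
  moreover have "(\<Sum>i\<in>UNIV. K i) / \<mu> \<ge> 0"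
    using K(1) \<mu>(1) by (simp add: sum_nonneg less_imp_le)
  moreover have "m - f x \<le> 1 \<and>
      (metric_norm g x (gradient A g f x))\<^sup>2 \<le> (\<Sum>i\<in>UNIV. K i) / \<mu> * (m - f x)" if x: "x \<in> U" for x
  proof
    define y where "y = snd c x"
    have xc: "x \<in> fst c" and y: "y \<in> ball y0 \<rho>" using x by (auto simp: U_def y_def)
    have yx: "chart_inv c y = x" using chart_inv_chart[OF c(1) xc] by (simp add: y_def)
    have yR: "y \<in> cball y0 R" and yV: "y \<in> V" using y \<rho>(2) R(2) by auto
    have yr: "y \<in> ball y0 (r i)" for i using y \<rho>(4)[of i] by simp
    have fx: "h y = f x" using h[OF yV] yx by simp
    have "dist (h y) (h y0) < 1" using y \<rho>(3) by (intro \<delta>(2)) (simp add: dist_commute[of y])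
    then show "m - f x \<le> 1" using hy0 fx by (simp add: dist_real_def)
    let ?D = "frechet_derivative (f \<circ> chart_inv c) (at (snd c x) within chart_image c)"
    have "snd c x \<in> interior (chart_image c)" using yV by (simp add: V_def y_def)
    \<comment> \<open>At interior points the derivative within the chart image is the full
      derivative, so it can be compared with that of \<open>h\<close>.\<close>
    then have "?D = frechet_derivative (f \<circ> chart_inv c) (at y)"
      by (simp only: at_within_interior y_def)
    also have "\<dots> = frechet_derivative h (at y)"
      by (rule frechet_derivative_transform_within_open[OF h_diff[OF yV] V(1) yV, symmetric])
        (simp only: h o_def)
    finally have D: "?D = frechet_derivative h (at y)" .
    have "(metric_norm g x (gradient A g f x))\<^sup>2 \<le> (\<Sum>i\<in>UNIV. (?D (axis i 1))\<^sup>2) / \<mu>"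
      using \<mu>(2)[OF yR] yx by (intro gradient_norm_le[OF c(1) xc f \<mu>(1)]) simp
    also have "\<dots> \<le> (\<Sum>i\<in>UNIV. K i * (m - h y)) / \<mu>"
      unfolding D using \<mu>(1) yr by (intro divide_right_mono sum_mono K(3)) auto
    also have "\<dots> = (\<Sum>i\<in>UNIV. K i) / \<mu> * (m - f x)"
      by (simp add: sum_distrib_right fx)
    finally show "(metric_norm g x (gradient A g f x))\<^sup>2 \<le> (\<Sum>i\<in>UNIV. K i) / \<mu> * (m - f x)" .
  qed
  ultimately show ?thesis by (intro exI[of _ U] exI[of _ "(\<Sum>i\<in>UNIV. K i) / \<mu>"]) simp
qed

end

section \<open>Compactness of \<Sigma> and passage to the exponent \<theta>\<close>

theorem theorem2p2:
  fixes M :: "'a topology"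
    and A :: "('a, 'n::finite) chart set"
    and g :: "'a \<Rightarrow> ('a, 'n) tangent \<Rightarrow> ('a, 'n) tangent \<Rightarrow> real"
    and f :: "'a \<Rightarrow> real"
    and fmax \<theta> :: real
    and \<Sigma> :: "'a set"
  assumes "riemannian_manifold_with_boundary M A g"
    and "CARD('n) \<ge> 2"
    and "smooth_function A f"
    and "\<exists>x\<in>topspace M. f x = fmax"
    and "\<forall>x\<in>topspace M. f x \<le> fmax"
    and "{x \<in> topspace M. f x = fmax} \<inter> manifold_boundary A = {}"
    and "\<Sigma> \<in> connected_components_of (subtopology M {x \<in> topspace M. f x = fmax})"
    and "compactin M \<Sigma>"
    and "\<theta> < 1"
  shows "\<exists>\<Omega> c. openin M \<Omega> \<and> \<Sigma> \<subseteq> \<Omega> \<and> c > 0 \<and>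
           (\<forall>x\<in>\<Omega>. (metric_norm g x (gradient A g f x))\<^sup>2 \<le> c * (fmax - f x) powr \<theta>)"
proof -
  interpret riemannian_manifold_with_boundary M A g by fact
  have sub: "\<Sigma> \<subseteq> {x \<in> topspace M. f x = fmax}"
    using connected_components_of_subset[OF assms(7)] by auto
  have "\<exists>U C. openin M U \<and> p \<in> U \<and> C \<ge> 0 \<and>
      (\<forall>x\<in>U. fmax - f x \<le> 1 \<and> (metric_norm g x (gradient A g f x))\<^sup>2 \<le> C * (fmax - f x))"
    if "p \<in> \<Sigma>" for p
    by (rule gradient_bound_near_maximum) (use assms sub that in auto)
  then obtain U C where U: "\<And>p. p \<in> \<Sigma> \<Longrightarrow> openin M (U p) \<and> p \<in> U p \<and> C p \<ge> 0 \<and>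
      (\<forall>x\<in>U p. fmax - f x \<le> 1 \<and> (metric_norm g x (gradient A g f x))\<^sup>2 \<le> C p * (fmax - f x))"
    by metis
  have cover: "\<Sigma> \<subseteq> \<Union>(U ` \<Sigma>)" "\<forall>V\<in>U ` \<Sigma>. openin M V" using U by auto
  then obtain F where "finite F" "F \<subseteq> U ` \<Sigma>" "\<Sigma> \<subseteq> \<Union>F"
    using compactinD[OF assms(8), of "U ` \<Sigma>"] by auto
  then obtain t where t: "t \<subseteq> \<Sigma>" "finite t" "\<Sigma> \<subseteq> \<Union>(U ` t)"
    by (metis finite_subset_image)
  \<comment> \<open>The sum dominates each of its nonnegative terms \<open>C p\<close>; the added 1
    makes \<open>c\<close> positive even if all of them vanish.\<close>
  define c where "c = 1 + (\<Sum>p\<in>t. C p)"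
  have C0: "\<And>p. p \<in> t \<Longrightarrow> C p \<ge> 0" using U t(1) by blast
  have "(metric_norm g x (gradient A g f x))\<^sup>2 \<le> c * (fmax - f x) powr \<theta>"
    if x: "x \<in> \<Union>(U ` t)" for x
  proof -
    obtain p where p: "p \<in> t" "x \<in> U p" using x by blast
    have Up: "openin M (U p)" "fmax - f x \<le> 1"
        "(metric_norm g x (gradient A g f x))\<^sup>2 \<le> C p * (fmax - f x)"
      using U p t(1) by auto
    have nonneg: "0 \<le> fmax - f x" using assms(5) openin_subset[OF Up(1)] p(2) by auto
    have "C p \<le> c" using member_le_sum[OF p(1), of C] C0 t(2) by (simp add: c_def)
    then have "C p * (fmax - f x) \<le> c * (fmax - f x)" using nonneg by (rule mult_right_mono)
    also have "\<dots> \<le> c * (fmax - f x) powr \<theta>"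
    proof (rule mult_left_mono)
      show "fmax - f x \<le> (fmax - f x) powr \<theta>"
        using powr_mono'[of \<theta> 1 "fmax - f x"] nonneg Up(2) assms(9) by simp
      show "0 \<le> c" using C0 by (simp add: c_def sum_nonneg add_nonneg_nonneg)
    qed
    finally show ?thesis using Up(3) by linarith
  qed
  moreover have "c > 0" using C0 by (simp add: c_def sum_nonneg add_pos_nonneg)
  moreover have "openin M (\<Union>(U ` t))" using U t(1) by (intro openin_Union) auto
  ultimately show ?thesis using t(3) by blast
qed

end
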